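(* There exist universal constants $\beta,c>0$ such that the following holds. Let $b>0$, let $m,T\ge1$ be integers, let $s\in\{1,\dots,\min(m,T)\}$, and let $N$ be an integer with $N\ge s(m+T)\log(2)/(8b^2)$. Then $$\inf_{\widehat M}\ \sup_{\substack{M^*\in bB_\infty\\ \mathrm{rank}(M^* )\le s}}\mathbb P_{M^*}^{\otimes N}\left(\frac1{\sqrt{mT}}\|\widehat M-M^*\|_{S_2}\ge c\sqrt{\frac{(m+T)s}{N}}\right)\ge\beta,$$ where the infimum is over all estimators $\widehat M$ (measurable $\mathbb R^{m\times T}$-valued functions of $(X_i,Y_i)_{i=1}^N$).
   Context: $bB_\infty=\{M\in\mathbb R^{m\times T}:\max_{p,q}|M_{p,q}|\le b\}$; $\|\cdot\|_{S_2}$ is the Frobenius norm; $(E_{p,q})$ is the canonical basis of $\mathbb R^{m\times T}$. For $M\in bB_\infty$, $\mathbb P_M^{\otimes N}$ is the distribution of $N$ i.i.d. pairs $(X_i,Y_i)$ distributed like $(X,Y)$, where $X$ is uniformly distributed on $\{E_{p,q}\}$, $Y\in\{-1,1\}$, and $\mathbb P_M(Y=1\mid X=E_{p,q})=\exp(M_{p,q})/[1+\exp(M_{p,q})]$. *)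

theory Defs
  imports "HOL-Probability.Probability" "Jordan_Normal_Form.DL_Rank"
begin

text \<open>
  The dimensions are quantified inside the statement (after the universal constants), so matrices
  are carrier-based rather than type-indexed. Rows and columns are indexed from 0.
  The rank is \<^const>\<open>vec_space.rank\<close>, whose first argument is the number of rows.
\<close>

definition canonical_mat :: "nat \<Rightarrow> nat \<Rightarrow> nat \<Rightarrow> nat \<Rightarrow> real mat" where
  "canonical_mat m T p q = mat m T (\<lambda>(i, j). if i = p \<and> j = q then 1 else 0)"

definition frobenius_norm :: "real mat \<Rightarrow> real" where
  "frobenius_norm A = sqrt (\<Sum>i<dim_row A. \<Sum>j<dim_col A. (A $$ (i, j))\<^sup>2)"

text \<open>Only meaningful for positive dimensions (the maximum is over the set of entries).\<close>

definition entry_max_norm :: "real mat \<Rightarrow> real" where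
  "entry_max_norm A = (MAX x\<in>elements_mat A. \<bar>x\<bar>)"

definition max_norm_ball :: "nat \<Rightarrow> nat \<Rightarrow> real \<Rightarrow> real mat set" where
  "max_norm_ball m T b = {M \<in> carrier_mat m T. entry_max_norm M \<le> b}"

definition low_rank_class :: "nat \<Rightarrow> nat \<Rightarrow> real \<Rightarrow> nat \<Rightarrow> real mat set" where
  "low_rank_class m T b s = {M \<in> max_norm_ball m T b. vec_space.rank m M \<le> s}"

text \<open>
  Joint law of a pair \<open>(X, Y)\<close>. The positions are in bijection with the canonical basis,
  so a uniform position gives a uniform \<open>X\<close>; given \<open>X\<close>, the sign is drawn by the logistic link.
\<close>

definition obs_pmf :: "nat \<Rightarrow> nat \<Rightarrow> real mat \<Rightarrow> (real mat \<times> int) pmf" where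
  "obs_pmf m T M =
     do { (p, q) \<leftarrow> pmf_of_set ({..<m} \<times> {..<T});
          y \<leftarrow> bernoulli_pmf (exp (M $$ (p, q)) / (1 + exp (M $$ (p, q))));
          return_pmf (canonical_mat m T p q, if y then 1 else - 1) }"

definition sample_measure ::
    "nat \<Rightarrow> nat \<Rightarrow> nat \<Rightarrow> real mat \<Rightarrow> (nat \<Rightarrow> real mat \<times> int) measure" where
  "sample_measure m T N M = (\<Pi>\<^sub>M i\<in>{..<N}. measure_pmf (obs_pmf m T M))"

text \<open>
  The sample \<open>\<sigma>\<close>-algebra does not depend on the parameter: it is the \<open>N\<close>-fold product of the discrete
  one, which are also the measurable sets of \<open>sample_measure\<close>. A matrix-valued function is measurable (for the Borel sets of the space of \<open>m \<times> T\<close>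
  matrices) iff its entries are.
\<close>

definition sample_space :: "nat \<Rightarrow> (nat \<Rightarrow> real mat \<times> int) measure" where
  "sample_space N = (\<Pi>\<^sub>M i\<in>{..<N}. count_space UNIV)"

definition estimators ::
    "nat \<Rightarrow> nat \<Rightarrow> nat \<Rightarrow> ((nat \<Rightarrow> real mat \<times> int) \<Rightarrow> real mat) set" where
  "estimators m T N =
     {Mhat. (\<forall>\<omega>\<in>space (sample_space N). Mhat \<omega> \<in> carrier_mat m T) \<and>
            (\<forall>i<m. \<forall>j<T. (\<lambda>\<omega>. Mhat \<omega> $$ (i, j)) \<in> borel_measurable (sample_space N))}"

end

theory Submission
  imports Defs
begin

text \<open>
  The hard matrices have entries \<open>\<plusminus> d\<close> with \<open>d\<^sup>2\<close> of order \<open>s (m + T) / N\<close>; their sign pattern repeats \<open>s\<close> free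
  rows (or columns) periodically, so the rank is at most \<open>s\<close>. Flipping one free sign changes at most
  \<open>4 m T / (s (m + T))\<close> entries and hence moves the affinity of the \<open>N\<close>-sample laws by a small constant only.
  Assouad's lemma then yields a pattern for which the estimator gets a constant fraction of the \<open>m T\<close> signs
  wrong on average. As at most \<open>m T\<close> signs can be wrong, this happens with probability bounded below
  (no Varshamov--Gilbert packing is needed), and each wrong sign costs at least \<open>d\<^sup>2\<close> in squared
  Frobenius norm.
\<close>

section \<open>Testing and Assouad's lemma for discrete distributions\<close>

text \<open>The two errors of a test add up to at least the sum of the pointwise minima of the
  masses. Pointwise, \<open>min a b\<close> dominates \<open>sqrt (a * b) - (a + b) / 4\<close>, and
  the subtracted part sums to 1/2 because both laws have total mass one on \<open>S\<close>. This
  linear form of Le Cam's bound needs no Cauchy-Schwarz step and is informative as soon as the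
  affinity exceeds 1/2.\<close>

lemma testing_error_affinity:
  fixes p q :: "'a pmf"
  assumes fin: "finite S" and p: "set_pmf p \<subseteq> S" and q: "set_pmf q \<subseteq> S"
  shows "(\<Sum>x\<in>S. sqrt (pmf p x * pmf q x)) - 1/2
           \<le> measure_pmf.prob p D + measure_pmf.prob q (- D)"
proof -
  have prob: "measure_pmf.prob r E = (\<Sum>x\<in>S. if x \<in> E then pmf r x else 0)"
    if "set_pmf r \<subseteq> S" for r :: "'a pmf" and E
  proof -
    have "measure_pmf.prob r E = measure_pmf.prob r (E \<inter> S)"
      using that by (intro measure_pmf.finite_measure_eq_AE) (auto simp: AE_measure_pmf_iff)
    also have "\<dots> = (\<Sum>x\<in>E \<inter> S. pmf r x)"
      using fin by (simp add: measure_measure_pmf_finite)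
    also have "\<dots> = (\<Sum>x\<in>S. if x \<in> E then pmf r x else 0)"
      using sum.inter_restrict[OF fin, of "pmf r" E] by (simp add: Int_commute)
    finally show ?thesis .
  qed
  have pw: "sqrt (a * b) - (a + b) / 4 \<le> min a b" if "a \<ge> 0" "b \<ge> 0" for a b :: real
  proof -
    \<comment> \<open>AM-GM for \<open>u\<close> and \<open>v / 4\<close>. It is applied with
      \<open>u\<close> the smaller and \<open>v\<close> the larger of \<open>a\<close> and
      \<open>b\<close>; subtracting \<open>(u + v) / 4\<close> then leaves \<open>3 * u / 4\<close>,
      which is at most \<open>u\<close>.\<close>
    have "sqrt (a * b) \<le> u + v / 4" if "a * b = u * v" "u \<ge> 0" "v \<ge> 0" for u v
    proof -
      have "0 \<le> (u - v / 4)\<^sup>2" by simp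
      then have "u * v \<le> (u + v / 4)\<^sup>2"
        by (simp add: power2_eq_square algebra_simps)
      then show ?thesis using that by (intro real_le_lsqrt) auto
    qed
    from this[of "min a b" "max a b"] that show ?thesis
      by (auto simp: min_def max_def field_simps)
  qed
  have "(\<Sum>x\<in>S. sqrt (pmf p x * pmf q x)) - 1/2
      = (\<Sum>x\<in>S. sqrt (pmf p x * pmf q x) - (pmf p x + pmf q x) / 4)"
    using fin p q
    by (simp add: sum_subtractf sum.distrib sum_divide_distrib[symmetric] sum_pmf_eq_1)
  also have "\<dots> \<le> (\<Sum>x\<in>S. min (pmf p x) (pmf q x))"
    by (intro sum_mono pw) auto
  also have "\<dots> \<le> (\<Sum>x\<in>S. (if x \<in> D then pmf p x else 0) + (if x \<in> - D then pmf q x else 0))"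
    by (intro sum_mono) auto
  also have "\<dots> = measure_pmf.prob p D + measure_pmf.prob q (- D)"
    using prob[OF p] prob[OF q] by (simp add: sum.distrib)
  finally show ?thesis .
qed

lemma sqrt_prod: "sqrt (\<Prod>i\<in>I. f i) = (\<Prod>i\<in>I. sqrt (f i))"
  by (induction I rule: infinite_finite_induct) (auto simp: real_sqrt_mult)

text \<open>The affinity tensorizes: the masses of the product laws are products over coordinates,
  so the sum over all samples is a product of identical sums. The default \<open>undefined\<close>
  of \<open>Pi_pmf\<close> agrees with extensionality in \<open>PiE\<close>.\<close>

lemma affinity_Pi_pmf:
  fixes p q :: "'a pmf"
  assumes "finite I" "finite S"
  shows "(\<Sum>f\<in>PiE I (\<lambda>_. S). sqrt (pmf (Pi_pmf I undefined (\<lambda>_. p)) f * pmf (Pi_pmf I undefined (\<lambda>_. q)) f))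
           = (\<Sum>x\<in>S. sqrt (pmf p x * pmf q x)) ^ card I"
proof -
  have "(\<Sum>x\<in>S. sqrt (pmf p x * pmf q x)) ^ card I = (\<Prod>i\<in>I. \<Sum>x\<in>S. sqrt (pmf p x * pmf q x))"
    by simp
  also have "\<dots> = (\<Sum>f\<in>PiE I (\<lambda>_. S). \<Prod>i\<in>I. sqrt (pmf p (f i) * pmf q (f i)))"
    using assms by (intro prod_sum_PiE) auto
  also have "\<dots> = (\<Sum>f\<in>PiE I (\<lambda>_. S). sqrt (pmf (Pi_pmf I undefined (\<lambda>_. p)) f * pmf (Pi_pmf I undefined (\<lambda>_. q)) f))"
  proof (intro sum.cong refl)
    fix f assume "f \<in> PiE I (\<lambda>_. S)"
    then have "f x = undefined" if "x \<notin> I" for x using that by (auto simp: PiE_iff extensional_def)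
    then show "(\<Prod>i\<in>I. sqrt (pmf p (f i) * pmf q (f i)))
        = sqrt (pmf (Pi_pmf I undefined (\<lambda>_. p)) f * pmf (Pi_pmf I undefined (\<lambda>_. q)) f)"
      using assms by (simp add: pmf_Pi' prod.distrib sqrt_prod real_sqrt_mult)
  qed
  finally show ?thesis by simp
qed

lemma set_Pi_pmf_subset_PiE:
  assumes "finite I" "set_pmf p \<subseteq> S"
  shows "set_pmf (Pi_pmf I undefined (\<lambda>_. p)) \<subseteq> PiE I (\<lambda>_. S)"
proof
  fix f assume "f \<in> set_pmf (Pi_pmf I undefined (\<lambda>_. p))"
  then have "f \<in> PiE_dflt I undefined (set_pmf \<circ> (\<lambda>_. p))"
    using set_Pi_pmf_subset'[OF assms(1), of undefined "\<lambda>_. p"] by blast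
  then show "f \<in> PiE I (\<lambda>_. S)"
    using assms(2) by (auto simp: PiE_dflt_def PiE_iff extensional_def)
qed

text \<open>Under a uniform prior on \<open>Pow L\<close>, the parameters pair up as
  \<open>A\<close> and \<open>insert k A\<close>. For the label \<open>k = g e\<close>, the event
  \<open>B e\<close> is a test between the two members of each pair, and its two errors sum to at
  least \<open>2 * \<alpha>\<close>. Hence each \<open>e\<close> has average error at least
  \<open>\<alpha>\<close>, and some \<open>A\<close> does no better than the average of the summed
  errors. Several \<open>e\<close> may share a label, each with its own test, so an estimator need
  not be projected onto the parameter cube first.\<close>

lemma assouad:
  fixes P :: "'l set \<Rightarrow> 'x pmf" and g :: "'e \<Rightarrow> 'l" and B :: "'e \<Rightarrow> 'x set"
  assumes finL: "finite L" and finG: "finite G" and g: "g ` G \<subseteq> L"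
    and sep: "\<And>A k D. A \<subseteq> L \<Longrightarrow> k \<in> L \<Longrightarrow> k \<notin> A \<Longrightarrow>
      2 * \<alpha> \<le> measure_pmf.prob (P A) D + measure_pmf.prob (P (insert k A)) (- D)"
  obtains A where "A \<subseteq> L"
    and "\<alpha> * real (card G) \<le> (\<Sum>e\<in>G. measure_pmf.prob (P A) {x. (x \<in> B e) \<noteq> (g e \<in> A)})"
proof -
  define err where "err A e = measure_pmf.prob (P A) {x. (x \<in> B e) \<noteq> (g e \<in> A)}" for A e
  have avg: "\<alpha> * real (card (Pow L)) \<le> (\<Sum>A\<in>Pow L. err A e)" if "e \<in> G" for e
  proof -
    define k where "k = g e"
    define L' where "L' = L - {k}"
    have k: "k \<in> L" using g that by (auto simp: k_def)
    then have L: "L = insert k L'" "k \<notin> L'" by (auto simp: L'_def)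
    have fin': "finite L'" using finL by (simp add: L'_def)
    have inj: "inj_on (insert k) (Pow L')"
      using L(2) by (auto simp: inj_on_def)
    have "(\<Sum>A\<in>Pow L. err A e) = (\<Sum>A\<in>Pow L'. err A e) + (\<Sum>A\<in>insert k ` Pow L'. err A e)"
      unfolding L(1) Pow_insert using fin' L(2) by (intro sum.union_disjoint) auto
    also have "\<dots> = (\<Sum>A\<in>Pow L'. err A e + err (insert k A) e)"
      using inj by (simp add: sum.reindex sum.distrib)
    also have "\<dots> \<ge> (\<Sum>A\<in>Pow L'. 2 * \<alpha>)"
    proof (intro sum_mono)
      fix A assume A: "A \<in> Pow L'"
      then have kA: "k \<notin> A" using L(2) by auto
      have "err A e = measure_pmf.prob (P A) (B e)"
        using kA by (simp add: err_def k_def)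
      moreover have "err (insert k A) e = measure_pmf.prob (P (insert k A)) (- B e)"
        by (simp add: err_def k_def Compl_eq)
      ultimately show "2 * \<alpha> \<le> err A e + err (insert k A) e"
        using sep[of A k "B e"] A k kA by (auto simp: L'_def)
    qed
    finally show ?thesis
      unfolding L(1) using L(2) fin' by (simp add: card_Pow mult_ac)
  qed
  have "\<exists>A\<in>Pow L. \<alpha> * real (card G) \<le> (\<Sum>e\<in>G. err A e)"
  proof (rule ccontr)
    assume "\<not> ?thesis"
    then have "(\<Sum>A\<in>Pow L. \<Sum>e\<in>G. err A e) < (\<Sum>A\<in>Pow L. \<alpha> * real (card G))"
      using finL by (intro sum_strict_mono) (auto simp: not_le)
    moreover have "(\<Sum>e\<in>G. \<alpha> * real (card (Pow L))) \<le> (\<Sum>e\<in>G. \<Sum>A\<in>Pow L. err A e)"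
      by (intro sum_mono avg)
    ultimately show False
      by (subst (asm) sum.swap) (simp add: mult_ac)
  qed
  then show thesis using that by (auto simp: err_def)
qed

text \<open>Reverse Markov inequality: the number of events that occur is at most \<open>card G\<close>.\<close>

lemma prob_many_events:
  fixes Q :: "'x pmf"
  assumes finG: "finite G" "G \<noteq> {}"
    and mean: "\<alpha> * real (card G) \<le> (\<Sum>e\<in>G. measure_pmf.prob Q (E e))"
    and a: "a \<ge> 0"
  shows "\<alpha> - a \<le> measure_pmf.prob Q {x. a * real (card G) \<le> real (card {e\<in>G. x \<in> E e})}"
proof -
  define n where "n = real (card G)"
  define F where "F = {x. a * n \<le> real (card {e\<in>G. x \<in> E e})}"
  have n: "n > 0" using finG by (simp add: n_def card_gt_0_iff)
  have int: "integrable (measure_pmf Q) (indicator X :: 'x \<Rightarrow> real)" for X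
    by (intro measure_pmf.integrable_const_bound[where B=1]) (auto simp: indicator_def)
  have "\<alpha> * n \<le> (\<Sum>e\<in>G. measure_pmf.expectation Q (indicator (E e)))"
    using mean by (simp add: n_def)
  also have "\<dots> = measure_pmf.expectation Q (\<lambda>x. \<Sum>e\<in>G. indicator (E e) x)"
    using int by (subst Bochner_Integration.integral_sum) auto
  \<comment> \<open>Pointwise, the count is below \<open>a * n\<close> off \<open>F\<close> and at
    most \<open>n\<close> on \<open>F\<close>.\<close>
  also have "\<dots> \<le> measure_pmf.expectation Q (\<lambda>x. a * n + n * indicator F x)"
  proof (intro integral_mono)
    fix x
    have "(\<Sum>e\<in>G. indicator (E e) x) = (\<Sum>e\<in>{e\<in>G. x \<in> E e}. 1 :: real)"
      using finG(1) by (intro sum.mono_neutral_cong_right) (auto simp: indicator_def)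
    then have eq: "(\<Sum>e\<in>G. indicator (E e) x) = real (card {e\<in>G. x \<in> E e})"
      by simp
    have "card {e\<in>G. x \<in> E e} \<le> card G" using finG by (intro card_mono) auto
    then have "real (card {e\<in>G. x \<in> E e}) \<le> n" by (simp add: n_def)
    moreover have "0 \<le> a * n" using a n by simp
    ultimately show "(\<Sum>e\<in>G. indicator (E e) x) \<le> a * n + n * indicator F x"
      unfolding eq by (auto simp: F_def indicator_def)
  qed (use int in auto)
  also have "\<dots> = a * n + n * measure_pmf.prob Q F"
    using int by simp
  finally have "n * (\<alpha> - a) \<le> n * measure_pmf.prob Q F"
    by (simp add: algebra_simps)
  then have "\<alpha> - a \<le> measure_pmf.prob Q F"
    using n by simp
  then show ?thesis by (simp add: F_def n_def)
qed

text \<open>Bridge between two models of an i.i.d. sample. Under \<open>Pi_pmf\<close> every set is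
  an event, so tests need no measurability argument; \<open>PiM\<close> is the model in which the
  risk is stated. The two laws agree on boxes, which determine a product measure.\<close>

lemma measure_PiM_measure_pmf:
  fixes p :: "'a pmf"
  assumes "finite I" and E: "E \<in> sets (PiM I (\<lambda>_. measure_pmf p))"
  shows "measure (PiM I (\<lambda>_. measure_pmf p)) E = measure_pmf.prob (Pi_pmf I undefined (\<lambda>_. p)) E"
proof -
  let ?Q = "Pi_pmf I undefined (\<lambda>_. p)" and ?M = "PiM I (\<lambda>_. measure_pmf p)"
  \<comment> \<open>\<open>Pi_pmf\<close> lives on all functions and \<open>PiM\<close> only on
    extensional ones. Restriction maps the first space into the second and is almost surely the
    identity.\<close>
  let ?r = "\<lambda>f. restrict f I"
  interpret product_sigma_finite "\<lambda>_. measure_pmf p"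
    by unfold_locales
  have meas: "?r \<in> measurable (measure_pmf ?Q) ?M"
    by (auto simp: space_PiM)
  have inv: "measure_pmf.prob ?Q (?r -` X) = measure_pmf.prob ?Q X" for X
    using set_Pi_pmf_subset_PiE[OF assms(1), of p UNIV]
    by (intro measure_pmf.finite_measure_eq_AE) (auto simp: AE_measure_pmf_iff PiE_iff extensional_restrict)
  have "distr (measure_pmf ?Q) ?M ?r = ?M"
  proof (rule PiM_eqI)
    fix A :: "'b \<Rightarrow> 'a set" assume "\<And>i. i \<in> I \<Longrightarrow> A i \<in> sets (measure_pmf p)"
    have "emeasure (distr (measure_pmf ?Q) ?M ?r) (PiE I A) = emeasure (measure_pmf ?Q) (?r -` PiE I A)"
      using assms(1) meas by (subst emeasure_distr) (auto intro!: sets_PiM_I_finite)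
    also have "?r -` PiE I A = Pi I A"
      by (auto simp: PiE_iff Pi_iff)
    also have "emeasure (measure_pmf ?Q) (Pi I A) = ennreal (measure_pmf.prob ?Q (PiE_dflt I undefined A))"
      unfolding measure_pmf.emeasure_eq_measure
      using set_Pi_pmf_subset[OF assms(1), of undefined "\<lambda>_. p"]
      by (intro arg_cong[where f=ennreal] measure_pmf.finite_measure_eq_AE)
         (auto simp: AE_measure_pmf_iff PiE_dflt_def Pi_iff)
    also have "\<dots> = (\<Prod>i\<in>I. emeasure (measure_pmf p) (A i))"
      using assms(1) by (simp add: measure_Pi_pmf_PiE_dflt measure_pmf.emeasure_eq_measure prod_ennreal)
    finally show "emeasure (distr (measure_pmf ?Q) ?M ?r) (PiE I A) = (\<Prod>i\<in>I. emeasure (measure_pmf p) (A i))" .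
  qed (use assms in auto)
  then have "measure ?M E = measure (distr (measure_pmf ?Q) ?M ?r) E"
    by simp
  also have "\<dots> = measure_pmf.prob ?Q (?r -` E)"
    using meas E by (simp add: measure_distr)
  finally show ?thesis by (simp add: inv)
qed

section \<open>The logistic observation model\<close>

definition logistic :: "real \<Rightarrow> real" where
  "logistic x = exp x / (1 + exp x)"

lemma logistic_bounds: "0 < logistic x" "logistic x < 1"
  by (auto simp: logistic_def field_simps add_pos_pos)

lemma logistic_minus: "logistic (- x) = 1 - logistic x"
proof -
  have "1 + exp x \<noteq> 0" using exp_gt_zero[of x] by linarith
  then show ?thesis by (simp add: logistic_def exp_minus divide_simps)
qed

text \<open>Changing an entry from \<open>d\<close> to \<open>- d\<close> swaps the success and
  failure probabilities, so the right-hand side is the affinity of the two sign laws. With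
  \<open>p = logistic d\<close> one has \<open>4 * p * (1 - p) = 1 - (2 * p - 1)^2\<close> and
  \<open>0 \<le> 2 * p - 1 \<le> d\<close>; moreover a number in the unit interval is at most its
  square root.\<close>

lemma affinity_logistic_minus:
  assumes "d > 0"
  shows "1 - d\<^sup>2 \<le> 2 * sqrt (logistic d * (1 - logistic d))"
proof -
  let ?p = "logistic d" and ?u = "logistic d * (1 - logistic d)"
  have e: "exp d \<ge> 1" using assms by simp
  have "1 + exp d \<noteq> 0" using e by linarith
  then have "2 * ?p - 1 = (exp d - 1) / (1 + exp d)"
    by (simp add: logistic_def divide_simps)
  also have "\<dots> \<le> (exp d - 1) / exp d"
    using e by (intro divide_left_mono) (auto intro!: mult_pos_pos add_pos_pos)
  also have "\<dots> = 1 - exp (- d)"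
    by (simp add: exp_minus field_simps)
  also have "\<dots> \<le> d"
    using exp_ge_add_one_self[of "- d"] by simp
  finally have up: "2 * ?p - 1 \<le> d" .
  have low: "0 \<le> 2 * ?p - 1"
    using e by (simp add: logistic_def field_simps add_pos_pos)
  have "(2 * ?p - 1)\<^sup>2 \<le> d\<^sup>2"
    using up low by (intro power_mono)
  then have 1: "1 - d\<^sup>2 \<le> 4 * ?u"
    by (simp add: power2_eq_square algebra_simps)
  have u0: "0 \<le> ?u" using logistic_bounds[of d] by simp
  have u1: "4 * ?u \<le> 1"
    using zero_le_power2[of "2 * ?p - 1"] by (simp add: power2_eq_square algebra_simps)
  have "(4 * ?u)\<^sup>2 \<le> 4 * ?u"
    using u0 u1 mult_left_le[of "4 * ?u" "4 * ?u"] by (simp add: power2_eq_square)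
  then have "4 * ?u \<le> sqrt (4 * ?u)"
    using real_le_rsqrt by blast
  also have "\<dots> = 2 * sqrt ?u"
    by (simp add: real_sqrt_mult)
  finally show ?thesis using 1 by simp
qed

definition obs_of :: "nat \<Rightarrow> nat \<Rightarrow> (nat \<times> nat) \<times> bool \<Rightarrow> real mat \<times> int" where
  "obs_of m T = (\<lambda>((i, j), y). (canonical_mat m T i j, if y then 1 else - 1))"

text \<open>A finite set that carries the observation law of every parameter matrix (for positive
  dimensions), so that affinities become finite sums over a common index set.\<close>

definition obs_support :: "nat \<Rightarrow> nat \<Rightarrow> (real mat \<times> int) set" where
  "obs_support m T = obs_of m T ` (({..<m} \<times> {..<T}) \<times> UNIV)"

lemma finite_obs_support [simp]: "finite (obs_support m T)"
  by (simp add: obs_support_def)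

lemma inj_on_obs_of: "inj_on (obs_of m T) (({..<m} \<times> {..<T}) \<times> UNIV)"
proof -
  have canon: "i = i' \<and> j = j'"
    if *: "canonical_mat m T i j = canonical_mat m T i' j'" "i < m" "j < T" for i j i' j'
  proof -
    have "canonical_mat m T i j $$ (i, j) = canonical_mat m T i' j' $$ (i, j)"
      by (simp add: *)
    then show ?thesis
      using that(2,3) by (simp add: canonical_mat_def split: if_splits)
  qed
  show ?thesis
  proof (intro inj_onI)
    fix x y assume *: "x \<in> ({..<m} \<times> {..<T}) \<times> UNIV" "y \<in> ({..<m} \<times> {..<T}) \<times> UNIV"
      "obs_of m T x = obs_of m T y"
    obtain i j u where x: "x = ((i, j), u)" by (metis surj_pair)
    obtain i' j' u' where y: "y = ((i', j'), u')" by (metis surj_pair)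
    have "canonical_mat m T i j = canonical_mat m T i' j'" "u = u'"
      using *(3) by (auto simp: x y obs_of_def split: if_splits)
    then show "x = y" using canon[of i j i' j'] *(1) by (simp add: x y)
  qed
qed

lemma obs_pmf_eq_map:
  "obs_pmf m T M = map_pmf (obs_of m T)
    (pmf_of_set ({..<m} \<times> {..<T}) \<bind> (\<lambda>e. map_pmf (Pair e) (bernoulli_pmf (logistic (M $$ e)))))"
proof -
  have eq: "map_pmf (obs_of m T) (map_pmf (Pair e) (bernoulli_pmf (logistic (M $$ e)))) =
     (case e of (p, q) \<Rightarrow> bernoulli_pmf (exp (M $$ (p, q)) / (1 + exp (M $$ (p, q)))) \<bind>
       (\<lambda>y. return_pmf (canonical_mat m T p q, if y then 1 else - 1)))" for e
    by (cases e) (simp add: map_pmf_def bind_assoc_pmf bind_return_pmf obs_of_def logistic_def)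
  show ?thesis
    unfolding obs_pmf_def map_bind_pmf eq ..
qed

lemma set_obs_pmf:
  assumes "m \<ge> 1" "T \<ge> 1"
  shows "set_pmf (obs_pmf m T M) \<subseteq> obs_support m T"
proof -
  have "{..<m} \<times> {..<T} \<noteq> {}" using assms by (auto simp: lessThan_empty_iff)
  then show ?thesis
    unfolding obs_pmf_eq_map by (auto simp: obs_support_def)
qed

lemma pmf_obs_pmf:
  assumes "m \<ge> 1" "T \<ge> 1" "e \<in> {..<m} \<times> {..<T}"
  shows "pmf (obs_pmf m T M) (obs_of m T (e, y)) =
    (if y then logistic (M $$ e) else 1 - logistic (M $$ e)) / (real m * real T)"
proof -
  let ?G = "{..<m} \<times> {..<T}"
  let ?R = "pmf_of_set ?G \<bind> (\<lambda>e. map_pmf (Pair e) (bernoulli_pmf (logistic (M $$ e))))"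
  have G: "finite ?G" "?G \<noteq> {}" using assms(3) by auto
  have "pmf (obs_pmf m T M) (obs_of m T (e, y)) = pmf ?R (e, y)"
  proof -
    have sub: "set_pmf ?R \<subseteq> ?G \<times> UNIV" using G by auto
    have "pmf (map_pmf (obs_of m T) ?R) (obs_of m T (e, y))
        = measure_pmf.prob ?R (obs_of m T -` {obs_of m T (e, y)})"
      by (simp add: pmf_map)
    also have "\<dots> = measure_pmf.prob ?R {(e, y)}"
    proof (intro measure_pmf.finite_measure_eq_AE)
      \<comment> \<open>Off the grid \<open>obs_of\<close> is not injective, since out-of-range
        positions all give the zero matrix. The preimage is therefore a singleton only up to a null
        set.\<close>
      show "AE x in measure_pmf ?R. (x \<in> obs_of m T -` {obs_of m T (e, y)}) = (x \<in> {(e, y)})"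
        unfolding AE_measure_pmf_iff
      proof
        fix x assume "x \<in> set_pmf ?R"
        then have "x \<in> ?G \<times> UNIV" using sub by blast
        then show "(x \<in> obs_of m T -` {obs_of m T (e, y)}) = (x \<in> {(e, y)})"
          using inj_on_eq_iff[OF inj_on_obs_of, of x m T "(e, y)"] assms(3) by auto
      qed
    qed auto
    finally show ?thesis by (simp add: obs_pmf_eq_map measure_pmf_single)
  qed
  also have "\<dots> = (\<Sum>e'\<in>?G. pmf (map_pmf (Pair e') (bernoulli_pmf (logistic (M $$ e')))) (e, y)) / real (card ?G)"
    using G by (simp add: pmf_bind integral_pmf_of_set)
  also have "(\<Sum>e'\<in>?G. pmf (map_pmf (Pair e') (bernoulli_pmf (logistic (M $$ e')))) (e, y))
      = (\<Sum>e'\<in>?G. if e' = e then pmf (bernoulli_pmf (logistic (M $$ e))) y else 0)"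
  proof (intro sum.cong refl)
    fix e' 
    have "pmf (map_pmf (Pair e') (bernoulli_pmf (logistic (M $$ e')))) (e', y)
        = pmf (bernoulli_pmf (logistic (M $$ e'))) y"
      by (rule pmf_map_inj') (auto simp: inj_def)
    moreover have "pmf (map_pmf (Pair e') (bernoulli_pmf (logistic (M $$ e')))) (e, y) = 0" if "e' \<noteq> e"
      using that by (auto simp: pmf_eq_0_set_pmf)
    ultimately show "pmf (map_pmf (Pair e') (bernoulli_pmf (logistic (M $$ e')))) (e, y)
        = (if e' = e then pmf (bernoulli_pmf (logistic (M $$ e))) y else 0)"
      by auto
  qed
  also have "\<dots> = (if y then logistic (M $$ e) else 1 - logistic (M $$ e))"
    using G(1) assms(3) logistic_bounds[of "M $$ e"] by (auto simp: sum.delta less_imp_le)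
  finally show ?thesis by simp
qed

text \<open>The position is uniform under both laws, so the affinity is the average over positions
  of the affinities of the sign laws. These are 1 where the entries agree and at least
  \<open>1 - d^2\<close> on the set \<open>R\<close> of flipped entries.\<close>

lemma affinity_obs_pmf:
  assumes mT: "m \<ge> 1" "T \<ge> 1"
    and d: "d > 0"
    and M: "\<And>e. e \<in> {..<m} \<times> {..<T} \<Longrightarrow> \<bar>M $$ e\<bar> = d"
    and M': "\<And>e. e \<in> {..<m} \<times> {..<T} \<Longrightarrow> M' $$ e = (if e \<in> R then - M $$ e else M $$ e)"
    and R: "R \<subseteq> {..<m} \<times> {..<T}"
  shows "1 - real (card R) * d\<^sup>2 / (real m * real T)
     \<le> (\<Sum>x\<in>obs_support m T. sqrt (pmf (obs_pmf m T M) x * pmf (obs_pmf m T M') x))"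
proof -
  let ?G = "{..<m} \<times> {..<T}"
  define K where "K = real m * real T"
  have K: "K > 0" using mT by (simp add: K_def)
  have cardG: "real (card ?G) = K" by (simp add: K_def)
  let ?f = "\<lambda>e y. sqrt (pmf (obs_pmf m T M) (obs_of m T (e, y)) * pmf (obs_pmf m T M') (obs_of m T (e, y)))"
  have "(\<Sum>x\<in>obs_support m T. sqrt (pmf (obs_pmf m T M) x * pmf (obs_pmf m T M') x))
      = (\<Sum>e\<in>?G. \<Sum>y\<in>UNIV. ?f e y)"
    unfolding obs_support_def
    by (subst sum.reindex[OF inj_on_obs_of]) (simp add: sum.cartesian_product split_beta)
  also have "\<dots> \<ge> (\<Sum>e\<in>?G. (1 - (if e \<in> R then d\<^sup>2 else 0)) / K)"
  proof (intro sum_mono)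
    fix e assume e: "e \<in> ?G"
    let ?l = "logistic (M $$ e)" and ?l' = "logistic (M' $$ e)"
    have "(\<Sum>y\<in>UNIV. ?f e y) = (sqrt (?l * ?l') + sqrt ((1 - ?l) * (1 - ?l'))) / K"
      using e mT K by (simp add: UNIV_bool pmf_obs_pmf K_def[symmetric] real_sqrt_divide
          real_sqrt_mult_self power2_eq_square[symmetric] add_divide_distrib add.commute)
    moreover have "1 - (if e \<in> R then d\<^sup>2 else 0) \<le> sqrt (?l * ?l') + sqrt ((1 - ?l) * (1 - ?l'))"
    proof (cases "e \<in> R")
      case True
      then have l': "?l' = 1 - ?l" using M'[OF e] by (simp add: logistic_minus)
      have "M $$ e = d \<or> M $$ e = - d" using M[OF e] by linarith
      then have "?l * ?l' = logistic d * (1 - logistic d)"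
        using l' by (auto simp: logistic_minus)
      then show ?thesis
        using affinity_logistic_minus[OF d] l' True by (simp add: mult.commute)
    next
      case False
      then show ?thesis using M'[OF e] logistic_bounds[of "M $$ e"] by simp
    qed
    ultimately show "(1 - (if e \<in> R then d\<^sup>2 else 0)) / K \<le> (\<Sum>y\<in>UNIV. ?f e y)"
      using K by (simp add: divide_right_mono)
  qed
  finally have "(\<Sum>e\<in>?G. (1 - (if e \<in> R then d\<^sup>2 else 0)) / K)
      \<le> (\<Sum>x\<in>obs_support m T. sqrt (pmf (obs_pmf m T M) x * pmf (obs_pmf m T M') x))" .
  moreover have "(\<Sum>e\<in>?G. (1 - (if e \<in> R then d\<^sup>2 else 0)) / K) = 1 - real (card R) * d\<^sup>2 / K"
  proof -
    have "(\<Sum>e\<in>?G. if e \<in> R then d\<^sup>2 else 0) = real (card R) * d\<^sup>2"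
      using R by (simp add: sum.inter_restrict[symmetric] Int_absorb1)
    then show ?thesis
      using K cardG by (simp add: sum_divide_distrib[symmetric] sum_subtractf diff_divide_distrib)
  qed
  ultimately show ?thesis by (simp add: K_def)
qed

section \<open>Sign matrices of low rank\<close>

lemma rank_sum_products_le:
  fixes f g :: "nat \<Rightarrow> nat \<Rightarrow> real"
  shows "vec_space.rank m (mat m T (\<lambda>(i, j). \<Sum>k<s. f k i * g k j)) \<le> s"
proof (induction s)
  case 0
  have "mat m T (\<lambda>(i, j). \<Sum>k<0. f k i * g k j) = 0\<^sub>m m T" by auto
  then show ?case using vec_space.rank_0I[of m T, where ?'a = real] by (metis order_refl)
next
  case (Suc s)
  let ?A = "mat m T (\<lambda>(i, j). \<Sum>k<s. f k i * g k j)" and ?B = "mat m T (\<lambda>(i, j). f s i * g s j)"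
  have "mat m T (\<lambda>(i, j). \<Sum>k<Suc s. f k i * g k j) = ?A + ?B" by auto
  moreover have "vec_space.rank m (?A + ?B) \<le> vec_space.rank m ?A + vec_space.rank m ?B"
    by (rule vec_space.rank_subadditive) auto
  moreover have "vec_space.rank m ?B \<le> 1"
    by (rule vec_space.rank_le_1_product_entries[where f = "f s" and g = "g s"]) auto
  ultimately show ?case using Suc by simp
qed

text \<open>Within a residue class the quotient by \<open>s\<close> determines the element, which
  leaves at most \<open>m div s + 1\<close> elements. The extra one is absorbed into the factor 2
  because \<open>s \<le> m\<close>.\<close>

lemma card_residue_class_le:
  fixes m s k :: nat
  assumes "1 \<le> s" "s \<le> m"
  shows "card {i. i < m \<and> i mod s = k} * s \<le> 2 * m"
proof -
  have "inj_on (\<lambda>i. i div s) {i. i < m \<and> i mod s = k}"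
    by (rule inj_onI) (metis (mono_tags, lifting) div_mult_mod_eq mem_Collect_eq)
  moreover have "(\<lambda>i. i div s) ` {i. i < m \<and> i mod s = k} \<subseteq> {..m div s}"
    by (auto intro: div_le_mono)
  ultimately have "card {i. i < m \<and> i mod s = k} \<le> card {..m div s}"
    by (intro card_inj_on_le) auto
  then have "card {i. i < m \<and> i mod s = k} * s \<le> (m div s + 1) * s"
    by (intro mult_right_mono) auto
  also have "\<dots> = m div s * s + s" by simp
  also have "\<dots> \<le> 2 * m"
    using assms div_times_less_eq_dividend[of m s] by linarith
  finally show ?thesis .
qed

text \<open>Positions with the same label under \<open>g\<close> share one free sign. Recording the
  positive labels as a set \<open>A\<close> makes flipping a sign the step from \<open>A\<close> to
  \<open>insert k A\<close> used in \<open>assouad\<close>.\<close>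

definition sign_mat :: "nat \<Rightarrow> nat \<Rightarrow> (nat \<times> nat \<Rightarrow> 'l) \<Rightarrow> real \<Rightarrow> 'l set \<Rightarrow> real mat" where
  "sign_mat m T g d A = mat m T (\<lambda>e. if g e \<in> A then d else - d)"

lemma sign_mat_in_low_rank_class:
  assumes "m \<ge> 1" "T \<ge> 1" "0 < d" "d \<le> b" "vec_space.rank m (sign_mat m T g d A) \<le> s"
  shows "sign_mat m T g d A \<in> low_rank_class m T b s"
proof -
  let ?M = "sign_mat m T g d A"
  have C: "?M \<in> carrier_mat m T" by (simp add: sign_mat_def)
  have fin: "finite (elements_mat ?M)" by (auto simp: elements_mat_def)
  have ne: "elements_mat ?M \<noteq> {}"
    using assms(1,2) elements_matI[OF C, of 0 0] by auto
  have "entry_max_norm ?M \<le> b"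
    unfolding entry_max_norm_def using fin ne
  proof (intro Max.boundedI)
    fix y assume "y \<in> abs ` elements_mat ?M"
    then obtain i j where "i < m" "j < T" "y = \<bar>?M $$ (i, j)\<bar>"
      by (auto simp: sign_mat_def dest: elements_matD)
    then show "y \<le> b" using assms(3,4) by (auto simp: sign_mat_def)
  qed auto
  then show ?thesis using C assms(5) by (simp add: low_rank_class_def max_norm_ball_def)
qed

text \<open>The shorter side is folded modulo \<open>s\<close> and the longer side is left free. At
  most \<open>s\<close> distinct rows (or columns) remain, which bounds the rank. A label is shared
  by at most \<open>2 * min m T / s\<close> positions, and \<open>m + T \<le> 2 * max m T\<close>
  gives the bound on the fibres.\<close>

lemma low_rank_labelling:
  fixes m T s :: nat
  assumes s: "1 \<le> s" "s \<le> m" "s \<le> T"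
  obtains g :: "nat \<times> nat \<Rightarrow> nat \<times> nat" where
    "\<And>k. card {e \<in> {..<m} \<times> {..<T}. g e = k} * (s * (m + T)) \<le> 4 * (m * T)"
    "\<And>d A. vec_space.rank m (sign_mat m T g d A) \<le> s"
proof (cases "m \<le> T")
  case True
  let ?g = "\<lambda>(i, j). (i mod s, j)"
  show thesis
  proof (rule that[of ?g])
    fix k :: "nat \<times> nat"
    obtain k1 k2 where k: "k = (k1, k2)" by force
    have "card {e \<in> {..<m} \<times> {..<T}. ?g e = k} \<le> card ({i. i < m \<and> i mod s = k1} \<times> {k2})"
      by (intro card_mono) (auto simp: k)
    then have "card {e \<in> {..<m} \<times> {..<T}. ?g e = k} \<le> card {i. i < m \<and> i mod s = k1}"
      by (simp add: card_cartesian_product)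
    then have "card {e \<in> {..<m} \<times> {..<T}. ?g e = k} * s \<le> 2 * m"
      using card_residue_class_le[OF s(1,2), of k1] by (meson le_trans mult_right_mono zero_le)
    then have "card {e \<in> {..<m} \<times> {..<T}. ?g e = k} * s * (m + T) \<le> 2 * m * (2 * T)"
      by (rule mult_le_mono) (use True in simp)
    then show "card {e \<in> {..<m} \<times> {..<T}. ?g e = k} * (s * (m + T)) \<le> 4 * (m * T)"
      by (simp add: algebra_simps)
  next
    fix d :: real and A :: "(nat \<times> nat) set"
    \<comment> \<open>Exactly one \<open>k\<close> below \<open>s\<close> equals
      \<open>i mod s\<close>, so the sum selects the row with that residue and exhibits a
      factorization of inner dimension \<open>s\<close>.\<close>
    have "sign_mat m T ?g d A = mat m T (\<lambda>(i, j). \<Sum>k<s. (if i mod s = k then 1 else 0) * (if (k, j) \<in> A then d else - d))"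
      using s(1) by (auto simp: sign_mat_def if_distrib[where f="\<lambda>x. x * _"] sum.delta' cong: if_cong)
    then show "vec_space.rank m (sign_mat m T ?g d A) \<le> s"
      using rank_sum_products_le[where m = m and T = T and s = s and f = "\<lambda>k i. if i mod s = k then 1 else 0" and g = "\<lambda>k j. if (k, j) \<in> A then d else - d"]
      by simp
  qed
next
  case False
  let ?g = "\<lambda>(i, j). (i, j mod s)"
  show thesis
  proof (rule that[of ?g])
    fix k :: "nat \<times> nat"
    obtain k1 k2 where k: "k = (k1, k2)" by force
    have "card {e \<in> {..<m} \<times> {..<T}. ?g e = k} \<le> card ({k1} \<times> {j. j < T \<and> j mod s = k2})"
      by (intro card_mono) (auto simp: k)
    then have "card {e \<in> {..<m} \<times> {..<T}. ?g e = k} \<le> card {j. j < T \<and> j mod s = k2}"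
      by (simp add: card_cartesian_product)
    then have "card {e \<in> {..<m} \<times> {..<T}. ?g e = k} * s \<le> 2 * T"
      using card_residue_class_le[OF s(1,3), of k2] by (meson le_trans mult_right_mono zero_le)
    then have "card {e \<in> {..<m} \<times> {..<T}. ?g e = k} * s * (m + T) \<le> 2 * T * (2 * m)"
      by (rule mult_le_mono) (use False in simp)
    then show "card {e \<in> {..<m} \<times> {..<T}. ?g e = k} * (s * (m + T)) \<le> 4 * (m * T)"
      by (simp add: algebra_simps)
  next
    fix d :: real and A :: "(nat \<times> nat) set"
    have "sign_mat m T ?g d A = mat m T (\<lambda>(i, j). \<Sum>k<s. (if (i, k) \<in> A then d else - d) * (if j mod s = k then 1 else 0))"
      using s(1) by (auto simp: sign_mat_def if_distrib[where f="\<lambda>x. _ * x"] sum.delta' cong: if_cong)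
    then show "vec_space.rank m (sign_mat m T ?g d A) \<le> s"
      using rank_sum_products_le[where m = m and T = T and s = s and f = "\<lambda>k i. if (i, k) \<in> A then d else - d" and g = "\<lambda>k j. if j mod s = k then 1 else 0"]
      by simp
  qed
qed

text \<open>At a wrongly signed position the entry of \<open>X\<close> and the target
  \<open>d\<close> or \<open>- d\<close> lie on opposite sides of zero (an entry 0 counts as
  negative), so they differ by at least \<open>d\<close>. A fraction \<open>a^2\<close> of wrong
  signs thus yields a factor \<open>a\<close> in the norm.\<close>

lemma frobenius_norm_ge_sign_errors:
  assumes C: "X \<in> carrier_mat m T" and d: "d > 0" and a: "a \<ge> 0"
    and errs: "a\<^sup>2 * real (card ({..<m} \<times> {..<T}))
      \<le> real (card {e \<in> {..<m} \<times> {..<T}. (0 < X $$ e) \<noteq> (g e \<in> A)})"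
  shows "a * d * sqrt (real m * real T) \<le> frobenius_norm (X - sign_mat m T g d A)"
proof -
  let ?G = "{..<m} \<times> {..<T}" and ?M = "sign_mat m T g d A"
  let ?W = "{e \<in> ?G. (0 < X $$ e) \<noteq> (g e \<in> A)}"
  have "(a * d * sqrt (real m * real T))\<^sup>2 = d\<^sup>2 * (a\<^sup>2 * real (card ?G))"
    by (simp add: power_mult_distrib)
  also have "\<dots> \<le> d\<^sup>2 * real (card ?W)"
    using errs by (intro mult_left_mono) auto
  also have "\<dots> = (\<Sum>e\<in>?W. d\<^sup>2)" by simp
  also have "\<dots> \<le> (\<Sum>e\<in>?W. ((X - ?M) $$ e)\<^sup>2)"
  proof (intro sum_mono)
    fix e assume e: "e \<in> ?W"
    then have "(X - ?M) $$ e = X $$ e - (if g e \<in> A then d else - d)"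
      using C by (auto simp: sign_mat_def)
    then have "\<bar>d\<bar> \<le> \<bar>(X - ?M) $$ e\<bar>"
      using e d by auto
    then show "d\<^sup>2 \<le> ((X - ?M) $$ e)\<^sup>2" by (simp add: abs_le_square_iff)
  qed
  also have "\<dots> \<le> (\<Sum>e\<in>?G. ((X - ?M) $$ e)\<^sup>2)"
    by (intro sum_mono2) auto
  also have "\<dots> = (\<Sum>i<m. \<Sum>j<T. ((X - ?M) $$ (i, j))\<^sup>2)"
    by (simp add: sum.cartesian_product split_beta)
  finally show ?thesis
    using C unfolding frobenius_norm_def by (simp add: sign_mat_def real_le_rsqrt)
qed

section \<open>The minimax bound\<close>

text \<open>Makes \<open>measure_PiM_measure_pmf\<close> applicable to the loss event. On matrices
  of the right shape the norm is an explicit expression in the entries, which are measurable for an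
  estimator.\<close>

lemma sets_frobenius_event:
  assumes Mhat: "Mhat \<in> estimators m T N" and M: "M \<in> carrier_mat m T"
  shows "{\<omega> \<in> space (sample_measure m T N M').
      t \<le> 1 / sqrt (real m * real T) * frobenius_norm (Mhat \<omega> - M)} \<in> sets (sample_measure m T N M')"
proof -
  let ?S = "sample_space N"
  have sp: "space (sample_measure m T N M') = space ?S"
    by (simp add: sample_measure_def sample_space_def space_PiM)
  have st: "sets (sample_measure m T N M') = sets ?S"
    unfolding sample_measure_def sample_space_def by (intro sets_PiM_cong) auto
  have [measurable]: "(\<lambda>\<omega>. Mhat \<omega> $$ (i, j)) \<in> borel_measurable ?S" if "i < m" "j < T" for i j
    using Mhat that by (auto simp: estimators_def)
  have "(\<lambda>\<omega>. sqrt (\<Sum>i<m. \<Sum>j<T. (Mhat \<omega> $$ (i, j) - M $$ (i, j))\<^sup>2)) \<in> borel_measurable ?S"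
    by measurable
  moreover have "frobenius_norm (Mhat \<omega> - M) = sqrt (\<Sum>i<m. \<Sum>j<T. (Mhat \<omega> $$ (i, j) - M $$ (i, j))\<^sup>2)"
    if "\<omega> \<in> space ?S" for \<omega>
    using Mhat M that by (auto simp: frobenius_norm_def estimators_def)
  ultimately have "(\<lambda>\<omega>. frobenius_norm (Mhat \<omega> - M)) \<in> borel_measurable ?S"
    by (simp cong: measurable_cong)
  then show ?thesis unfolding sp st by measurable
qed

lemma exists_hard_matrix:
  assumes b: "b > 0" and mT: "m \<ge> 1" "T \<ge> 1" and s: "s \<in> {1..min m T}"
    and N: "real N \<ge> real s * (real m + real T) * ln 2 / (8 * b\<^sup>2)"
    and Mhat: "Mhat \<in> estimators m T N"
  shows "\<exists>M\<in>low_rank_class m T b s. 1/16 \<le> measure (sample_measure m T N M)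
            {\<omega> \<in> space (sample_measure m T N M).
               1 / sqrt (real m * real T) * frobenius_norm (Mhat \<omega> - M)
                 \<ge> 1/16 * sqrt ((real m + real T) * real s / real N)}"
proof -
  let ?G = "{..<m} \<times> {..<T}"
  define h where "h = (real m + real T) * real s / real N"
  \<comment> \<open>The factor 1/4 serves two purposes: flipping one label costs at most
    \<open>1 / (4 * real N)\<close> of affinity per observation, and the sample size condition gives
    \<open>d \<le> b\<close>.\<close>
  define d where "d = sqrt h / 4"
  have sp: "0 < (real m + real T) * real s" using mT s by auto
  have "0 < real s * (real m + real T) * ln 2 / (8 * b\<^sup>2)"
    using sp b by (simp add: mult.commute)
  with N have N0: "0 < real N" by linarith
  have h: "h > 0" using sp N0 by (simp add: h_def)
  have d: "d > 0" using h by (simp add: d_def)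
  have d2: "d\<^sup>2 = h / 16" using h by (simp add: d_def power_divide)
  \<comment> \<open>This is the sample size condition solved for \<open>h\<close>. With
    \<open>ln 2 \<ge> 1/2\<close> it becomes \<open>h \<le> 16 * b^2\<close>, that is
    \<open>d^2 \<le> b^2\<close>.\<close>
  have "h * ln 2 \<le> 8 * b\<^sup>2"
    using N N0 b by (simp add: h_def field_simps)
  moreover have "h * (1/2) \<le> h * ln 2"
    using h ln2_ge_two_thirds by (intro mult_left_mono) auto
  ultimately have "d\<^sup>2 \<le> b\<^sup>2" using d2 by simp
  then have db: "d \<le> b" using b power2_le_imp_le[of d b] by simp
  obtain g :: "nat \<times> nat \<Rightarrow> nat \<times> nat" where
    fibre: "\<And>k. card {e \<in> ?G. g e = k} * (s * (m + T)) \<le> 4 * (m * T)"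
    and rank: "\<And>d A. vec_space.rank m (sign_mat m T g d A) \<le> s"
    using low_rank_labelling[of s m T] s by auto
  define P where "P A = Pi_pmf {..<N} undefined (\<lambda>_. obs_pmf m T (sign_mat m T g d A))" for A
  \<comment> \<open>The sign of the estimated entry at \<open>e\<close> serves as the test for the
    label of \<open>e\<close>.\<close>
  define B where "B e = {\<omega>. 0 < Mhat \<omega> $$ e}" for e
  \<comment> \<open>The error sum 1/4 is 3/4 - 1/2: the \<open>N\<close>-sample affinity is at least
    3/4, and \<open>testing_error_affinity\<close> loses 1/2.\<close>
  have sep: "2 * (1/8) \<le> measure_pmf.prob (P A) D + measure_pmf.prob (P (insert k A)) (- D)"
    if A: "k \<notin> A" for A k D
  proof -
    let ?M = "sign_mat m T g d A" and ?M' = "sign_mat m T g d (insert k A)"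
    let ?R = "{e \<in> ?G. g e = k}"
    let ?a = "\<Sum>x\<in>obs_support m T. sqrt (pmf (obs_pmf m T ?M) x * pmf (obs_pmf m T ?M') x)"
    have "real (card ?R) * ((real m + real T) * real s) \<le> 4 * (real m * real T)"
      using of_nat_mono[OF fibre[of k], where ?'a = real] by (simp add: algebra_simps)
    then have "real (card ?R) * ((real m + real T) * real s) / (real m * real T) \<le> 4"
      using mT by (simp add: divide_le_eq)
    then have "real (card ?R) * ((real m + real T) * real s) / (real m * real T) / real N \<le> 4 / real N"
      by (intro divide_right_mono) auto
    then have "real (card ?R) * h / (real m * real T) \<le> 4 / real N"
      by (simp add: h_def mult_ac)
    then have "real (card ?R) * d\<^sup>2 / (real m * real T) \<le> 1 / (4 * real N)"
      by (simp add: d2) (simp add: field_simps)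
    moreover have "1 - real (card ?R) * d\<^sup>2 / (real m * real T) \<le> ?a"
      by (rule affinity_obs_pmf[OF mT d]) (use A d in \<open>auto simp: sign_mat_def\<close>)
    ultimately have a: "1 - 1 / (4 * real N) \<le> ?a" by linarith
    have N1: "real N \<ge> 1" using N0 by simp
    \<comment> \<open>Bernoulli's inequality turns a loss of \<open>1 / (4 * real N)\<close> per
      observation into a total loss of at most 1/4.\<close>
    have "3/4 \<le> 1 + real N * (- (1 / (4 * real N)))"
      using N0 by simp
    also have "\<dots> \<le> (1 + - (1 / (4 * real N))) ^ N"
      using N1 by (intro Bernoulli_inequality) (auto simp: field_simps)
    also have "\<dots> \<le> ?a ^ N"
      using a N1 by (intro power_mono) (auto simp: field_simps)
    also have "\<dots> = (\<Sum>f\<in>PiE {..<N} (\<lambda>_. obs_support m T). sqrt (pmf (P A) f * pmf (P (insert k A)) f))"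
      using affinity_Pi_pmf[of "{..<N}" "obs_support m T"] by (simp add: P_def)
    finally have "3/4 \<le> (\<Sum>f\<in>PiE {..<N} (\<lambda>_. obs_support m T). sqrt (pmf (P A) f * pmf (P (insert k A)) f))" .
    moreover have "set_pmf (P X) \<subseteq> PiE {..<N} (\<lambda>_. obs_support m T)" for X
      unfolding P_def using mT by (intro set_Pi_pmf_subset_PiE set_obs_pmf) auto
    ultimately show ?thesis
      using testing_error_affinity[of "PiE {..<N} (\<lambda>_. obs_support m T)" "P A" "P (insert k A)" D]
      by (simp add: finite_PiE)
  qed
  obtain A where mean: "1/8 * real (card ?G)
      \<le> (\<Sum>e\<in>?G. measure_pmf.prob (P A) {\<omega>. (\<omega> \<in> B e) \<noteq> (g e \<in> A)})"
    by (rule assouad[of "g ` ?G" ?G g "1/8" P B]) (use sep in auto)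
  let ?M = "sign_mat m T g d A"
  let ?E = "{\<omega> \<in> space (sample_measure m T N ?M). 1/16 * sqrt h \<le> 1 / sqrt (real m * real T) * frobenius_norm (Mhat \<omega> - ?M)}"
  let ?F = "{\<omega>. 1/16 * real (card ?G) \<le> real (card {e\<in>?G. \<omega> \<in> {\<omega>. (\<omega> \<in> B e) \<noteq> (g e \<in> A)}})}"
  have "?G \<noteq> {}" using mT by (auto simp: lessThan_empty_iff)
  \<comment> \<open>The mean fraction of wrong signs is at least 1/8; with threshold 1/16 the
    reverse Markov inequality leaves probability 1/8 - 1/16.\<close>
  then have "1/16 \<le> measure_pmf.prob (P A) ?F"
    using prob_many_events[OF _ _ mean, of "1/16"] by simp
  also have "\<dots> \<le> measure_pmf.prob (P A) ?E"
  proof (intro measure_pmf.finite_measure_mono_AE)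
    show "AE \<omega> in measure_pmf (P A). \<omega> \<in> ?F \<longrightarrow> \<omega> \<in> ?E"
      unfolding AE_measure_pmf_iff
    proof (intro ballI impI)
      fix \<omega> assume \<omega>: "\<omega> \<in> set_pmf (P A)" "\<omega> \<in> ?F"
      have spc: "\<omega> \<in> space (sample_measure m T N ?M)"
        using \<omega>(1) set_Pi_pmf_subset_PiE[of "{..<N}" _ UNIV]
        by (auto simp: P_def sample_measure_def space_PiM)
      then have C: "Mhat \<omega> \<in> carrier_mat m T"
        using Mhat by (auto simp: estimators_def sample_measure_def sample_space_def space_PiM)
      \<comment> \<open>The fraction 1/16 of wrong signs is the square of 1/4. Together with
        \<open>d = sqrt h / 4\<close> this produces the constant 1/16 in the rate.\<close>
      have "1/4 * d * sqrt (real m * real T) \<le> frobenius_norm (Mhat \<omega> - ?M)"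
        using \<omega>(2) by (intro frobenius_norm_ge_sign_errors[OF C d]) (auto simp: B_def power_divide)
      then have "1/16 * sqrt h \<le> 1 / sqrt (real m * real T) * frobenius_norm (Mhat \<omega> - ?M)"
        using mT by (simp add: d_def field_simps)
      then show "\<omega> \<in> ?E" using spc by simp
    qed
  qed auto
  also have "\<dots> = measure (sample_measure m T N ?M) ?E"
  proof -
    have "?E \<in> sets (sample_measure m T N ?M)"
      by (rule sets_frobenius_event[OF Mhat]) (simp add: sign_mat_def)
    moreover have "measure_pmf.prob (P A) X = measure (sample_measure m T N ?M) X"
      if "X \<in> sets (sample_measure m T N ?M)" for X
      using measure_PiM_measure_pmf[of "{..<N}" X "obs_pmf m T ?M"] that
      by (simp add: P_def sample_measure_def)
    ultimately show ?thesis by blast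
  qed
  finally show ?thesis
    using sign_mat_in_low_rank_class[OF mT d db rank] unfolding h_def by blast
qed

theorem theorem4p3:
  shows "\<exists>\<beta> c :: real. \<beta> > 0 \<and> c > 0 \<and>
    (\<forall>(b::real) (m::nat) (T::nat) (s::nat) (N::nat).
       b > 0 \<longrightarrow> m \<ge> 1 \<longrightarrow> T \<ge> 1 \<longrightarrow> s \<in> {1..min m T} \<longrightarrow>
       real N \<ge> real s * (real m + real T) * ln 2 / (8 * b\<^sup>2) \<longrightarrow>
       (INF Mhat\<in>estimators m T N. SUP M\<in>low_rank_class m T b s.
          measure (sample_measure m T N M)
            {\<omega> \<in> space (sample_measure m T N M).
               1 / sqrt (real m * real T) * frobenius_norm (Mhat \<omega> - M)
                 \<ge> c * sqrt ((real m + real T) * real s / real N)})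
       \<ge> \<beta>)"
proof (rule exI[of _ "1/16"], rule exI[of _ "1/16"], intro conjI allI impI)
  fix b :: real and m T s N :: nat
  assume *: "b > 0" "m \<ge> 1" "T \<ge> 1" "s \<in> {1..min m T}"
    "real N \<ge> real s * (real m + real T) * ln 2 / (8 * b\<^sup>2)"
  have prob: "prob_space (sample_measure m T N M)" for M
    unfolding sample_measure_def by (intro prob_space_PiM measure_pmf.prob_space_axioms)
  show "1/16 \<le> (INF Mhat\<in>estimators m T N. SUP M\<in>low_rank_class m T b s.
          measure (sample_measure m T N M)
            {\<omega> \<in> space (sample_measure m T N M).
               1 / sqrt (real m * real T) * frobenius_norm (Mhat \<omega> - M)
                 \<ge> 1/16 * sqrt ((real m + real T) * real s / real N)})"
  proof (rule cINF_greatest)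
    \<comment> \<open>The infimum is taken in the reals, so it needs a nonempty index set; a
      constant estimator provides one.\<close>
    have "(\<lambda>_. 0\<^sub>m m T) \<in> estimators m T N" by (simp add: estimators_def)
    then show "estimators m T N \<noteq> {}" by blast
  next
    fix Mhat assume "Mhat \<in> estimators m T N"
    from exists_hard_matrix[OF * this] obtain M where M: "M \<in> low_rank_class m T b s"
      "1/16 \<le> measure (sample_measure m T N M)
            {\<omega> \<in> space (sample_measure m T N M).
               1 / sqrt (real m * real T) * frobenius_norm (Mhat \<omega> - M)
                 \<ge> 1/16 * sqrt ((real m + real T) * real s / real N)}" by blast
    \<comment> \<open>A real supremum dominates its members only if the family is bounded above;
      here all members are probabilities.\<close>
    show "1/16 \<le> (SUP M\<in>low_rank_class m T b s. measure (sample_measure m T N M)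
            {\<omega> \<in> space (sample_measure m T N M).
               1 / sqrt (real m * real T) * frobenius_norm (Mhat \<omega> - M)
                 \<ge> 1/16 * sqrt ((real m + real T) * real s / real N)})"
      by (rule cSUP_upper2[where x = M]) (use M in \<open>auto intro!: bdd_aboveI[of _ 1] prob_space.prob_le_1[OF prob]\<close>)
  qed
qed auto

end
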